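(* Let $\mathcal H$ be a $P_0$-Donsker collection of measurable functions $h:\Xi\to\mathbb R$ with an $L^2$-integrable envelope, that is, there is $M_2:\Xi\to\mathbb R_+$ with $|h(\xi)|\le M_2(\xi)$ for all $h\in\mathcal H$, $\xi\in\Xi$, and $\mathbb E_{P_0}[M_2(\xi)^2]<\infty$. Let $f$ satisfy the smoothness assumption in the context and $\rho>0$. Let $\xi_1,\xi_2,\dots$ be i.i.d. with distribution $P_0$, with empirical distributions $\widehat P_n$. Then $$\sup_{P\ll\widehat P_n:\,D_f(P\|\widehat P_n)\le\rho/n}\mathbb E_P[h(\xi)]=\mathbb E_{\widehat P_n}[h(\xi)]+\sqrt{\frac\rho n\operatorname{Var}_{\widehat P_n}(h(\xi))}+\varepsilon_n(h),$$ where $\sup_{h\in\mathcal H}\sqrt n\,|\varepsilon_n(h)|\to0$ in outer probability.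
   Context: $(\Xi,\mathcal A,P_0)$ is a probability space. $\mathcal L^\infty(\mathcal H)$ is the space of bounded real-valued functionals on $\mathcal H\subset L^2(P_0)$ with the norm $\|L\|_{\mathcal H}=\sup_{h\in\mathcal H}|Lh|$; a measure $\mu$ acts by $\mu h=\int h\,d\mu$. $\mathcal H$ is $P_0$-Donsker if $\sqrt n(\widehat P_n-P_0)$ converges in distribution in $\mathcal L^\infty(\mathcal H)$ (in the outer-expectation sense of van der Vaart and Wellner) to a tight Borel measurable element $G$ of $\mathcal L^\infty(\mathcal H)$. Smoothness assumption on $f$: $f:[0,\infty)\to\mathbb R\cup\{+\infty\}$ is lower semicontinuous and convex, three times differentiable in a neighborhood of $1$, with $f(1)=f'(1)=0$ and $f''(1)=2$. For probability measures $P\ll Q$, $D_f(P\|Q)=\int f\!\left(\frac{dP}{dQ}\right)dQ$. $\operatorname{Var}_{\widehat P_n}(h)=\mathbb E_{\widehat P_n}[h^2]-\mathbb E_{\widehat P_n}[h]^2$. *)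

theory Defs
  imports "HOL-Probability.Probability"
begin

text \<open>\<open>e2ennreal\<close> maps negative values to \<open>0\<close>, so the two integrals are those of the positive and
  of the negative part.  The value is meaningful when at least one of them is finite.\<close>

definition quasi_integrable :: "'w measure \<Rightarrow> ('w \<Rightarrow> ereal) \<Rightarrow> bool" where
  "quasi_integrable M U \<longleftrightarrow> U \<in> borel_measurable M \<and>
     ((\<integral>\<^sup>+ w. e2ennreal (U w) \<partial>M) < \<infinity> \<or> (\<integral>\<^sup>+ w. e2ennreal (- U w) \<partial>M) < \<infinity>)"

definition ext_integral :: "'w measure \<Rightarrow> ('w \<Rightarrow> ereal) \<Rightarrow> ereal" where
  "ext_integral M U =
     enn2ereal (\<integral>\<^sup>+ w. e2ennreal (U w) \<partial>M) - enn2ereal (\<integral>\<^sup>+ w. e2ennreal (- U w) \<partial>M)"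

definition outer_expectation :: "'w measure \<Rightarrow> ('w \<Rightarrow> ereal) \<Rightarrow> ereal" where
  "outer_expectation M T =
     (INF U \<in> {U. quasi_integrable M U \<and> (\<forall>w \<in> space M. T w \<le> U w)}. ext_integral M U)"

definition tendsto_zero_in_outer_prob :: "'w measure \<Rightarrow> (nat \<Rightarrow> 'w \<Rightarrow> ennreal) \<Rightarrow> bool" where
  "tendsto_zero_in_outer_prob M X \<longleftrightarrow>
     (\<forall>e>0::real. (\<lambda>n. outer_measure_of M {w \<in> space M. X n w > ennreal e}) \<longlonglongrightarrow> 0)"

definition borel_of_topology :: "'d topology \<Rightarrow> 'd measure" where
  "borel_of_topology X = sigma (topspace X) {U. openin X U}"

text \<open>Only the law \<open>\<mu>\<close> of the limit matters: a Borel measurable random element has a Borel law,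
  and every Borel law is the law of the identity map.\<close>

definition tight_borel_law :: "'d topology \<Rightarrow> 'd measure \<Rightarrow> bool" where
  "tight_borel_law X \<mu> \<longleftrightarrow> prob_space \<mu> \<and> sets \<mu> = sets (borel_of_topology X) \<and>
     (\<forall>e>0. \<exists>K. compactin X K \<and> measure \<mu> K \<ge> 1 - e)"

definition converges_in_distribution ::
    "'w measure \<Rightarrow> 'd topology \<Rightarrow> (nat \<Rightarrow> 'w \<Rightarrow> 'd) \<Rightarrow> 'd measure \<Rightarrow> bool" where
  "converges_in_distribution M X Z \<mu> \<longleftrightarrow>
     (\<forall>g :: 'd \<Rightarrow> real. continuous_map X euclidean g \<and> bounded (g ` topspace X) \<longrightarrow>
        (\<lambda>n. outer_expectation M (\<lambda>w. ereal (g (Z n w)))) \<longlonglongrightarrow> ereal (\<integral>z. g z \<partial>\<mu>))"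

text \<open>The image of the uniform distribution on \<open>{0, \<dots>, n - 1}\<close> under a sample \<open>x\<close>, that is,
  the average of the point masses at \<open>x 0, \<dots>, x (n - 1)\<close>.\<close>

definition empirical_measure :: "'a measure \<Rightarrow> nat \<Rightarrow> (nat \<Rightarrow> 'a) \<Rightarrow> 'a measure" where
  "empirical_measure P0 n x = distr (uniform_count_measure {..<n}) P0 x"

definition empirical_process ::
    "'a measure \<Rightarrow> ('a \<Rightarrow> real) set \<Rightarrow> nat \<Rightarrow> (nat \<Rightarrow> 'a) \<Rightarrow> ('a \<Rightarrow> real) \<Rightarrow> real" where
  "empirical_process P0 H n x =
     (\<lambda>h \<in> H. sqrt (real n) * ((\<integral>z. h z \<partial>empirical_measure P0 n x) - (\<integral>z. h z \<partial>P0)))"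

text \<open>\<open>funspace\<close> carries the supremum distance; its elements are \<open>undefined\<close> outside \<open>H\<close>.\<close>

abbreviation bounded_functionals :: "'b set \<Rightarrow> ('b \<Rightarrow> real) metric" where
  "bounded_functionals H \<equiv> funspace H euclidean_metric"

text \<open>As outer expectations depend on the underlying probability space, the Donsker property refers,
  as in van der Vaart and Wellner, to the coordinate projections of the infinite product space.\<close>

definition donsker :: "'a measure \<Rightarrow> ('a \<Rightarrow> real) set \<Rightarrow> bool" where
  "donsker P0 H \<longleftrightarrow>
     (\<forall>h \<in> H. h \<in> borel_measurable P0 \<and> integrable P0 (\<lambda>z. (h z)\<^sup>2)) \<and>
     (\<forall>n. \<forall>x \<in> space (PiM UNIV (\<lambda>_::nat. P0)).
        empirical_process P0 H n x \<in> mspace (bounded_functionals H)) \<and>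
     (\<exists>\<mu>. tight_borel_law (mtopology_of (bounded_functionals H)) \<mu> \<and>
        converges_in_distribution (PiM UNIV (\<lambda>_::nat. P0))
          (mtopology_of (bounded_functionals H)) (empirical_process P0 H) \<mu>)"

text \<open>A function \<open>[0, \<infinity>) \<rightarrow> \<real> \<union> {+\<infinity>}\<close> is represented by a function
  on all reals whose values on the negative reals are irrelevant.\<close>

definition smooth_divergence_function :: "(real \<Rightarrow> ereal) \<Rightarrow> bool" where
  "smooth_divergence_function f \<longleftrightarrow>
     (\<forall>x\<ge>0. f x \<noteq> -\<infinity>) \<and>
     (\<forall>x\<ge>0. f x \<le> Liminf (at x within {0..}) f) \<and>
     (\<forall>x\<ge>0. \<forall>y\<ge>0. \<forall>t\<in>{0..1}.
        f ((1 - t) * x + t * y) \<le> ereal (1 - t) * f x + ereal t * f y) \<and>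
     (\<forall>\<^sub>F x in nhds 1. \<bar>f x\<bar> \<noteq> \<infinity> \<and>
        (\<forall>k<3. (deriv ^^ k) (\<lambda>u. real_of_ereal (f u)) differentiable (at x))) \<and>
     f 1 = 0 \<and>
     deriv (\<lambda>u. real_of_ereal (f u)) 1 = 0 \<and>
     (deriv ^^ 2) (\<lambda>u. real_of_ereal (f u)) 1 = 2"

definition f_divergence :: "(real \<Rightarrow> ereal) \<Rightarrow> 'a measure \<Rightarrow> 'a measure \<Rightarrow> ereal" where
  "f_divergence f P Q = ext_integral Q (\<lambda>z. f (enn2real (RN_deriv Q P z)))"

definition divergence_ball :: "(real \<Rightarrow> ereal) \<Rightarrow> 'a measure \<Rightarrow> real \<Rightarrow> 'a measure set" where
  "divergence_ball f Q r =
     {P. prob_space P \<and> sets P = sets Q \<and> absolutely_continuous Q P \<and> f_divergence f P Q \<le> ereal r}"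

definition variance_under :: "'a measure \<Rightarrow> ('a \<Rightarrow> real) \<Rightarrow> real" where
  "variance_under Q h = (\<integral>z. (h z)\<^sup>2 \<partial>Q) - (\<integral>z. h z \<partial>Q)\<^sup>2"

end

theory Submission
  imports Defs
begin

text \<open>Near \<open>1\<close>, \<open>f (1 + t) = t\<^sup>2 + o(t\<^sup>2)\<close>, and by convexity \<open>f (1 + t)\<close> grows at least linearly
  in \<open>\<bar>t\<bar>\<close> away from \<open>1\<close>.  Let \<open>P\<close> be in the divergence ball of radius \<open>\<rho> / n\<close>, with density \<open>1 + t\<close>.
  Then \<open>E\<^sub>P h - E\<^sub>n h\<close> is the integral of \<open>t (h - E\<^sub>n h)\<close>.
  By Cauchy-Schwarz, the part where \<open>t\<close> is small contributes at most about
  \<open>sqrt (\<rho> / n * Var h)\<close>, and the part where \<open>t\<close> is large at most a constant times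
  \<open>(1 / n) * max \<bar>h(\<xi>\<^sub>i)\<bar>\<close>, by linear growth.  Conversely, the density \<open>1 + a (h - E\<^sub>n h)\<close> with
  suitable \<open>a\<close> attains the bound to first order unless the variance is small, in which case \<open>E\<^sub>n h\<close>
  is a good enough lower bound.  These estimates are uniform over all \<open>h\<close> with
  \<open>max \<bar>h(\<xi>\<^sub>i)\<bar> \<le> \<tau> sqrt n\<close> and \<open>E\<^sub>n[h\<^sup>2] \<le> K\<close>.  Both conditions are inherited from the
  envelope \<open>M2\<close>: the maximum of \<open>M2(\<xi>\<^sub>i)\<close> is \<open>o(sqrt n)\<close> in probability by a union bound and
  dominated convergence, and \<open>E\<^sub>n[M2\<^sup>2]\<close> is bounded in probability by Markov's inequality.\<close>

section \<open>Local expansion and growth of the divergence function\<close>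

text \<open>As \<open>deriv g\<close> has derivative 2 at its zero \<open>a\<close>, the derivative
  of \<open>s\<close> \<mapsto> \<open>g (a + s) - s\<^sup>2\<close> is at most
  \<open>\<delta> * \<bar>s\<bar>\<close> in absolute value near 0. The mean value inequality on the
  interval from \<open>-\<bar>t\<bar>\<close> to \<open>\<bar>t\<bar>\<close> then supplies the
  second factor \<open>\<bar>t\<bar>\<close>.\<close>

lemma quadratic_approximation:
  fixes g :: "real \<Rightarrow> real"
  assumes diff: "\<forall>\<^sub>F x in nhds a. g differentiable (at x)"
    and diff': "deriv g differentiable (at a)"
    and "g a = 0" "deriv g a = 0" "deriv (deriv g) a = 2" "\<delta> > 0"
  shows "\<exists>\<eta>>0. \<forall>t. \<bar>t\<bar> \<le> \<eta> \<longrightarrow> \<bar>g (a + t) - t\<^sup>2\<bar> \<le> \<delta> * t\<^sup>2"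
proof -
  obtain d where d: "d > 0" "\<And>x. dist x a < d \<Longrightarrow> g differentiable (at x)"
    using diff unfolding eventually_nhds_metric by blast
  have "(deriv g has_field_derivative 2) (at a)"
    using diff' assms(5) DERIV_deriv_iff_real_differentiable by metis
  then have "(deriv g has_derivative (\<lambda>t. 2 * t)) (at a within UNIV)"
    by (simp add: has_field_derivative_def)
  then obtain c where c: "c > 0"
    "\<And>y. \<bar>y - a\<bar> < c \<Longrightarrow> \<bar>deriv g y - 2 * (y - a)\<bar> \<le> \<delta> * \<bar>y - a\<bar>"
    using assms(4,6) unfolding has_derivative_within_alt by (force simp: algebra_simps)
  define \<eta> where "\<eta> = min c d / 2"
  have \<eta>: "\<eta> > 0" "\<eta> < c" "\<eta> < d" using c(1) d(1) by (auto simp: \<eta>_def)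
  have "\<bar>g (a + t) - t\<^sup>2\<bar> \<le> \<delta> * t\<^sup>2" if t: "\<bar>t\<bar> \<le> \<eta>" for t
  proof -
    have der: "((\<lambda>s. g (a + s) - s\<^sup>2) has_field_derivative (deriv g (a + s) - 2 * s)) (at s within {-\<bar>t\<bar>..\<bar>t\<bar>})"
      if s: "s \<in> {-\<bar>t\<bar>..\<bar>t\<bar>}" for s
    proof -
      have "dist (a + s) a < d" using s t \<eta> by (auto simp: dist_real_def)
      then have "(g has_field_derivative deriv g (a + s)) (at (a + s))"
        using d(2) DERIV_deriv_iff_real_differentiable by blast
      then have "((\<lambda>s. g (a + s)) has_field_derivative deriv g (a + s)) (at s)"
        using DERIV_chain2[of g "deriv g (a + s)" "\<lambda>s. a + s" s 1 UNIV]
          DERIV_add[OF DERIV_const[of a] DERIV_ident] by simp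
      from DERIV_diff[OF this DERIV_pow[of 2 s]] show ?thesis
        by (simp add: has_field_derivative_at_within)
    qed
    have "norm ((g (a + t) - t\<^sup>2) - (g (a + 0) - 0\<^sup>2)) \<le> (\<delta> * \<bar>t\<bar>) * norm (t - 0)"
    proof (rule field_differentiable_bound[OF _ der])
      fix s assume s: "s \<in> {-\<bar>t\<bar>..\<bar>t\<bar>}"
      have "\<bar>deriv g (a + s) - 2 * s\<bar> \<le> \<delta> * \<bar>s\<bar>"
        using c(2)[of "a + s"] s t \<eta> by auto
      also have "\<dots> \<le> \<delta> * \<bar>t\<bar>" using s assms(6) by (intro mult_left_mono) auto
      finally show "norm (deriv g (a + s) - 2 * s) \<le> \<delta> * \<bar>t\<bar>" by simp
    qed auto
    then show ?thesis using assms(3) by (simp add: power2_eq_square)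
  qed
  then show ?thesis using \<eta>(1) by blast
qed

lemma divergence_function_quadratic:
  assumes f: "smooth_divergence_function f" and "\<delta> > 0"
  shows "\<exists>\<eta>. 0 < \<eta> \<and> \<eta> < 1 \<and> (\<forall>t. \<bar>t\<bar> \<le> \<eta> \<longrightarrow>
    ereal ((1 - \<delta>) * t\<^sup>2) \<le> f (1 + t) \<and> f (1 + t) \<le> ereal ((1 + \<delta>) * t\<^sup>2))"
proof -
  let ?g = "\<lambda>u. real_of_ereal (f u)"
  have ev: "\<forall>\<^sub>F x in nhds 1. \<bar>f x\<bar> \<noteq> \<infinity> \<and> (\<forall>k<3. (deriv ^^ k) ?g differentiable (at x))"
    and vals: "f 1 = 0" "deriv ?g 1 = 0" "deriv (deriv ?g) 1 = 2"
    using f by (auto simp: smooth_divergence_function_def numeral_2_eq_2)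
  have d0: "\<forall>\<^sub>F x in nhds 1. ?g differentiable (at x)"
    using ev
  proof eventually_elim
    case (elim x)
    then have "(deriv ^^ 0) ?g differentiable (at x)" by (metis zero_less_numeral)
    then show ?case by simp
  qed
  have d1: "deriv ?g differentiable (at 1)"
  proof -
    have "(deriv ^^ 1) ?g differentiable (at 1)"
      using eventually_nhds_x_imp_x[OF ev] by (auto simp del: funpow.simps dest!: spec[of _ "1::nat"])
    then show ?thesis by simp
  qed
  obtain \<eta>1 where \<eta>1: "\<eta>1 > 0" "\<And>t. \<bar>t\<bar> \<le> \<eta>1 \<Longrightarrow> \<bar>?g (1 + t) - t\<^sup>2\<bar> \<le> \<delta> * t\<^sup>2"
    using quadratic_approximation[OF d0 d1 _ vals(2,3) \<open>\<delta> > 0\<close>] vals(1) by auto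
  obtain d where d: "d > 0" "\<And>x. dist x 1 < d \<Longrightarrow> \<bar>f x\<bar> \<noteq> \<infinity>"
    using eventually_mono[OF ev, of "\<lambda>x. \<bar>f x\<bar> \<noteq> \<infinity>"]
    by (auto simp: eventually_nhds_metric)
  \<comment> \<open>Within \<open>d/2\<close> of 1 the values of \<open>f\<close> are finite, so
    \<open>real_of_ereal\<close> loses nothing there; the bound \<open>1/2\<close> keeps
    \<open>1 + t\<close> positive.\<close>
  define \<eta> where "\<eta> = min (1/2) (min \<eta>1 (d/2))"
  have \<eta>: "0 < \<eta>" "\<eta> < 1" "\<eta> \<le> \<eta>1" "\<eta> < d" using \<eta>1 d by (auto simp: \<eta>_def)
  have "ereal ((1 - \<delta>) * t\<^sup>2) \<le> f (1 + t) \<and> f (1 + t) \<le> ereal ((1 + \<delta>) * t\<^sup>2)"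
    if t: "\<bar>t\<bar> \<le> \<eta>" for t
  proof -
    obtain y where "f (1 + t) = ereal y"
      using d(2)[of "1 + t"] t \<eta> by (cases "f (1 + t)") (auto simp: dist_real_def)
    moreover have "\<bar>?g (1 + t) - t\<^sup>2\<bar> \<le> \<delta> * t\<^sup>2" using \<eta>1(2) t \<eta> by auto
    ultimately show ?thesis by (auto simp: algebra_simps abs_le_iff)
  qed
  with \<eta> show ?thesis by blast
qed

text \<open>The point \<open>1 + l * t\<close> with \<open>l = \<eta> / \<bar>t\<bar>\<close> lies
  on the segment from 1 to \<open>1 + t\<close>, at distance \<open>\<eta>\<close> from 1. Convexity
  and \<open>f 1 = 0\<close> give \<open>f (1 + l * t)\<close> \<le> \<open>l * f (1 + t)\<close>,
  and the quadratic bound is still available on the left.\<close>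

lemma divergence_function_linear_growth:
  assumes f: "smooth_divergence_function f" and "0 < \<eta>" "\<eta> < 1" "0 \<le> c"
    and near: "\<And>t. \<bar>t\<bar> \<le> \<eta> \<Longrightarrow> ereal (c * t\<^sup>2) \<le> f (1 + t)"
    and t: "t \<ge> -1" "\<eta> < \<bar>t\<bar>"
  shows "ereal (c * (\<eta> * \<bar>t\<bar>)) \<le> f (1 + t)"
proof -
  define l where "l = \<eta> / \<bar>t\<bar>"
  have l: "0 < l" "l \<le> 1" "\<bar>l * t\<bar> = \<eta>" using assms by (auto simp: l_def abs_mult)
  have conv: "\<forall>x\<ge>0. \<forall>y\<ge>0. \<forall>s\<in>{0..1}.
      f ((1 - s) * x + s * y) \<le> ereal (1 - s) * f x + ereal s * f y" and f1: "f 1 = 0"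
    and ninf: "\<forall>x\<ge>0. f x \<noteq> -\<infinity>"
    using f by (auto simp: smooth_divergence_function_def)
  have "(l * t)\<^sup>2 = \<eta>\<^sup>2" using l(3) by (metis power2_abs)
  then have "ereal (c * \<eta>\<^sup>2) \<le> f (1 + l * t)"
    using near[of "l * t"] l by simp
  also have "1 + l * t = (1 - l) * 1 + l * (1 + t)" by (simp add: algebra_simps)
  also have "f \<dots> \<le> ereal (1 - l) * f 1 + ereal l * f (1 + t)"
    using l t by (intro conv[rule_format]) auto
  finally have *: "ereal (c * \<eta>\<^sup>2) \<le> ereal l * f (1 + t)" using f1 by simp
  show ?thesis
  proof (cases "f (1 + t)")
    case (real r)
    then have "c * \<eta>\<^sup>2 \<le> l * r" using * by simp
    then have "c * \<eta>\<^sup>2 * \<bar>t\<bar> \<le> \<eta> * r" using assms(2) t(2) by (simp add: l_def field_simps)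
    then have "c * (\<eta> * \<bar>t\<bar>) \<le> r" using assms(2) by (simp add: power2_eq_square)
    then show ?thesis using real by simp
  qed (use ninf t in auto)
qed

text \<open>A Huber-like minorant. The branches agree at \<open>\<bar>t\<bar> = \<eta>\<close>, but
  the slope drops there from \<open>2 * \<eta>\<close> to \<open>\<eta>\<close>: the slope of the
  chord from the origin is what convexity yields for larger deviations.\<close>

definition quadratic_linear :: "real \<Rightarrow> real \<Rightarrow> real" where
  "quadratic_linear \<eta> t = (if \<bar>t\<bar> \<le> \<eta> then t\<^sup>2 else \<eta> * \<bar>t\<bar>)"

lemma quadratic_linear_nonneg: "0 < \<eta> \<Longrightarrow> 0 \<le> quadratic_linear \<eta> t"
  by (simp add: quadratic_linear_def)

lemma borel_measurable_quadratic_linear [measurable]: "quadratic_linear \<eta> \<in> borel_measurable borel"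
  unfolding quadratic_linear_def [abs_def] by measurable

lemma divergence_function_ge_quadratic_linear:
  assumes f: "smooth_divergence_function f" and "0 < \<eta>" "\<eta> < 1" "0 \<le> c"
    and near: "\<And>t. \<bar>t\<bar> \<le> \<eta> \<Longrightarrow> ereal (c * t\<^sup>2) \<le> f (1 + t)" and "0 \<le> x"
  shows "ereal (c * quadratic_linear \<eta> (x - 1)) \<le> f x"
  using near[of "x - 1"] divergence_function_linear_growth[OF f assms(2-4) near, of "x - 1"] assms(6)
  by (auto simp: quadratic_linear_def)

text \<open>Follows from the minorant with \<open>c = 1/2\<close>. It removes the negative part from
  \<open>ext_integral\<close>, so divergences become nonnegative integrals that can be compared by
  monotonicity.\<close>

lemma divergence_function_nonneg:
  assumes f: "smooth_divergence_function f" and "0 \<le> x"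
  shows "0 \<le> f x"
proof -
  obtain \<eta> where \<eta>: "0 < \<eta>" "\<eta> < 1" "\<And>t. \<bar>t\<bar> \<le> \<eta> \<Longrightarrow> ereal ((1/2) * t\<^sup>2) \<le> f (1 + t)"
    using divergence_function_quadratic[OF f, of "1/2"] by auto
  have "0 \<le> ereal ((1/2) * quadratic_linear \<eta> (x - 1))"
    using quadratic_linear_nonneg[OF \<eta>(1)] by simp
  also have "\<dots> \<le> f x"
    using divergence_function_ge_quadratic_linear[OF f \<eta>(1,2) _ \<eta>(3) assms(2)] by simp
  finally show ?thesis .
qed

lemma f_divergence_eq_nn_integral:
  assumes "smooth_divergence_function f"
  shows "f_divergence f P Q = enn2ereal (\<integral>\<^sup>+ z. e2ennreal (f (enn2real (RN_deriv Q P z))) \<partial>Q)"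
proof -
  have "(\<integral>\<^sup>+ z. e2ennreal (- f (enn2real (RN_deriv Q P z))) \<partial>Q) = (\<integral>\<^sup>+ z. 0 \<partial>Q)"
    using divergence_function_nonneg[OF assms] by (intro nn_integral_cong e2ennreal_neg) simp
  then show ?thesis by (simp add: f_divergence_def ext_integral_def zero_ennreal.rep_eq)
qed

lemma f_divergence_le_iff:
  assumes "smooth_divergence_function f" "0 \<le> r"
  shows "f_divergence f P Q \<le> ereal r \<longleftrightarrow>
    (\<integral>\<^sup>+ z. e2ennreal (f (enn2real (RN_deriv Q P z))) \<partial>Q) \<le> ennreal r"
  unfolding f_divergence_eq_nn_integral[OF assms(1)]
  using assms(2) by (simp add: less_eq_ennreal.rep_eq)

section \<open>Bounds over a divergence ball around a fixed probability measure\<close>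

lemma Cauchy_Schwarz_integral:
  fixes u v :: "'b \<Rightarrow> real"
  assumes [simp]: "integrable M (\<lambda>x. (u x)\<^sup>2)" "integrable M (\<lambda>x. (v x)\<^sup>2)" "integrable M (\<lambda>x. u x * v x)"
  shows "(\<integral>x. u x * v x \<partial>M) \<le> sqrt (\<integral>x. (u x)\<^sup>2 \<partial>M) * sqrt (\<integral>x. (v x)\<^sup>2 \<partial>M)"
proof -
  let ?A = "\<integral>x. (u x)\<^sup>2 \<partial>M" and ?B = "\<integral>x. (v x)\<^sup>2 \<partial>M" and ?C = "\<integral>x. u x * v x \<partial>M"
  have eq: "(\<lambda>x. (a * u x - b * v x)\<^sup>2) = (\<lambda>x. a\<^sup>2 * (u x)\<^sup>2 - (2 * a * b) * (u x * v x) + b\<^sup>2 * (v x)\<^sup>2)" for a b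
    by (auto simp: power2_eq_square algebra_simps)
  have quad: "0 \<le> a\<^sup>2 * ?A - (2 * a * b) * ?C + b\<^sup>2 * ?B" for a b
  proof -
    have "0 \<le> (\<integral>x. (a * u x - b * v x)\<^sup>2 \<partial>M)" by simp
    then show ?thesis unfolding eq by simp
  qed
  have nn: "?A \<ge> 0" "?B \<ge> 0" by auto
  have "?C\<^sup>2 \<le> ?A * ?B"
  proof (cases "?B = 0")
    case True
    have "?C = 0"
    proof (rule ccontr)
      assume "?C \<noteq> 0"
      \<comment> \<open>With vanishing \<open>?B\<close> this choice of \<open>b\<close> turns the
        quadratic form into -1.\<close>
      then show False using quad[of 1 "(?A + 1) / (2 * ?C)"] True by simp
    qed
    then show ?thesis using True by simp
  next
    case False
    have "0 \<le> ?B * (?A * ?B - ?C\<^sup>2)"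
      using quad[of ?B ?C] by (simp add: power2_eq_square algebra_simps)
    then show ?thesis using False nn by (simp add: zero_le_mult_iff)
  qed
  then have "sqrt (?C\<^sup>2) \<le> sqrt (?A * ?B)" by (rule real_sqrt_le_mono)
  then show ?thesis by (simp add: real_sqrt_mult)
qed

lemma power2_le_if_abs_le: "\<bar>x\<bar> \<le> B \<Longrightarrow> x\<^sup>2 \<le> B\<^sup>2" for x B :: real
  by (metis abs_ge_zero power2_abs power_mono)

context prob_space begin

lemma variance_under_eq:
  assumes "h \<in> borel_measurable M" "AE z in M. \<bar>h z\<bar> \<le> B"
  shows "variance_under M h = variance h"
proof -
  have "integrable M h" using assms by (intro integrable_const_bound[of _ B]) auto
  moreover have "integrable M (\<lambda>z. (h z)\<^sup>2)"
    using assms by (intro integrable_const_bound[of _ "B\<^sup>2"])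
      (auto simp: power2_le_if_abs_le elim!: eventually_mono)
  ultimately show ?thesis by (simp add: variance_under_def variance_eq)
qed

lemma abs_expectation_le:
  fixes h :: "'a \<Rightarrow> real"
  assumes "h \<in> borel_measurable M" "AE z in M. \<bar>h z\<bar> \<le> B"
  shows "\<bar>expectation h\<bar> \<le> B"
proof -
  have "integrable M h" using assms by (intro integrable_const_bound[of _ B]) auto
  then have "\<bar>expectation h\<bar> \<le> (\<integral>z. \<bar>h z\<bar> \<partial>M)" by (intro integral_abs_bound)
  also have "\<dots> \<le> (\<integral>z. B \<partial>M)"
    using assms \<open>integrable M h\<close> by (intro integral_mono_AE) auto
  finally show ?thesis by (simp add: prob_space)
qed

text \<open>The deviation \<open>t\<close> of the density from 1 splits at \<open>\<eta>\<close>
  into a small part \<open>u\<close> and a large part \<open>v\<close>. The minorant charges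
  \<open>c * u\<^sup>2\<close> for the first and \<open>c * \<eta> * v\<close> for the second, and
  the total is at most \<open>r\<close>. So \<open>u\<close> is controlled in L2, to be paired with
  the centred \<open>h\<close> by Cauchy-Schwarz, and \<open>v\<close> in L1, to be paired with
  \<open>2 * B\<close>. The constant \<open>c\<close> is left free because the sharp leading term
  needs it close to 1.\<close>

lemma expectation_le_of_mem_divergence_ball:
  assumes f: "smooth_divergence_function f" and \<eta>: "0 < \<eta>" "\<eta> < 1" and c: "0 < c"
    and near: "\<And>t. \<bar>t\<bar> \<le> \<eta> \<Longrightarrow> ereal (c * t\<^sup>2) \<le> f (1 + t)"
    and h [measurable]: "h \<in> borel_measurable M" and B: "AE z in M. \<bar>h z\<bar> \<le> B"
    and r: "0 \<le> r" and P: "P \<in> divergence_ball f M r"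
  shows "(\<integral>z. h z \<partial>P) \<le> expectation h + sqrt (r / c * variance_under M h) + 2 * B * r / (c * \<eta>)"
proof -
  have P': "prob_space P" "sets P = sets M" "absolutely_continuous M P" "f_divergence f P M \<le> ereal r"
    using P by (auto simp: divergence_ball_def)
  interpret P: prob_space P by fact
  define L where "L z = enn2real (RN_deriv M P z)" for z
  define t where "t z = L z - 1" for z
  define m where "m = expectation h"
  have [measurable]: "L \<in> borel_measurable M" "t \<in> borel_measurable M"
    by (auto simp: L_def [abs_def] t_def [abs_def])
  have dens: "integral\<^sup>L P u = (\<integral>z. L z * u z \<partial>M)" "integrable P u \<longleftrightarrow> integrable M (\<lambda>z. L z * u z)"
    if "u \<in> borel_measurable M" for u :: "'a \<Rightarrow> real"
    using RN_deriv_integral[OF P.sigma_finite_measure_axioms P'(3,2) that]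
      RN_deriv_integrable[OF P.sigma_finite_measure_axioms P'(3,2) that]
    by (auto simp: L_def)
  have L: "integrable M L" "(\<integral>z. L z \<partial>M) = 1"
    using dens[of "\<lambda>_. 1"] P.prob_space by auto
  have t: "integrable M t" "(\<integral>z. t z \<partial>M) = 0"
    using L by (auto simp: t_def [abs_def] prob_space)
  have m: "\<bar>m\<bar> \<le> B" unfolding m_def by (rule abs_expectation_le[OF h B])
  then have B0: "0 \<le> B" by simp
  have int_h: "integrable M h" using B by (intro integrable_const_bound[of _ B]) auto
  have int_Lh: "integrable M (\<lambda>z. L z * h z)"
    by (rule Bochner_Integration.integrable_bound[OF integrable_mult_right[OF L(1), of B]])
      (use B in \<open>auto simp: abs_mult L_def mult.commute[of B] elim!: eventually_mono intro!: mult_left_mono\<close>)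
  have int_th: "integrable M (\<lambda>z. t z * (h z - m))"
  proof -
    have "(\<lambda>z. t z * (h z - m)) = (\<lambda>z. L z * h z - h z - m * t z)"
      by (auto simp: t_def algebra_simps)
    then show ?thesis using int_Lh int_h t by simp
  qed
  \<comment> \<open>As \<open>t\<close> integrates to 0, \<open>h\<close> may be centred at no cost;
    this is why the variance appears below instead of the second moment.\<close>
  have eq: "(\<integral>z. h z \<partial>P) - m = (\<integral>z. t z * (h z - m) \<partial>M)"
  proof -
    have "(\<lambda>z. t z * (h z - m)) = (\<lambda>z. L z * h z - h z - m * t z)"
      by (auto simp: t_def algebra_simps)
    then show ?thesis using int_Lh int_h t by (simp add: dens m_def)
  qed
  let ?q = "\<lambda>z. c * quadratic_linear \<eta> (t z)"
  have "(\<integral>\<^sup>+ z. ennreal (?q z) \<partial>M) \<le> (\<integral>\<^sup>+ z. e2ennreal (f (L z)) \<partial>M)"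
  proof (rule nn_integral_mono)
    fix z
    have "ereal (?q z) \<le> f (L z)"
      unfolding t_def
      by (rule divergence_function_ge_quadratic_linear[OF f \<eta> _ near]) (use c in \<open>auto simp: L_def\<close>)
    from e2ennreal_mono[OF this] show "ennreal (?q z) \<le> e2ennreal (f (L z))" by simp
  qed
  also have "\<dots> \<le> ennreal r"
    using P'(4) by (simp add: f_divergence_le_iff[OF f r] L_def)
  finally have q_le: "(\<integral>\<^sup>+ z. ennreal (?q z) \<partial>M) \<le> ennreal r" .
  have q0: "0 \<le> ?q z" for z using quadratic_linear_nonneg[OF \<eta>(1)] c by simp
  have int_q: "integrable M ?q"
    by (rule integrableI_nonneg) (use q_le q0 in \<open>auto intro: le_less_trans\<close>)
  have "ennreal (\<integral>z. ?q z \<partial>M) \<le> ennreal r"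
    using q_le nn_integral_eq_integral[OF int_q] q0 by simp
  then have Iq: "(\<integral>z. ?q z \<partial>M) \<le> r" using r by (simp add: ennreal_le_iff)
  define u where "u z = (if \<bar>t z\<bar> \<le> \<eta> then t z else 0)" for z
  define v where "v z = (if \<bar>t z\<bar> \<le> \<eta> then 0 else \<bar>t z\<bar>)" for z
  have [measurable]: "u \<in> borel_measurable M" "v \<in> borel_measurable M"
    by (auto simp: u_def [abs_def] v_def [abs_def])
  have int_u2: "integrable M (\<lambda>z. (u z)\<^sup>2)"
    by (rule integrable_const_bound[of _ "\<eta>\<^sup>2"])
      (use \<eta> in \<open>auto simp: u_def power2_le_if_abs_le\<close>)
  have int_v: "integrable M v"
    by (rule Bochner_Integration.integrable_bound[OF t(1)]) (auto simp: v_def)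
  have h2: "AE z in M. (h z - m)\<^sup>2 \<le> (2 * B)\<^sup>2"
    using B by eventually_elim (rule power2_le_if_abs_le, use m in linarith)
  have int_h2: "integrable M (\<lambda>z. (h z - m)\<^sup>2)"
    by (rule integrable_const_bound[OF _ ]) (use h2 in auto)
  have int_uh: "integrable M (\<lambda>z. u z * (h z - m))"
    by (rule Bochner_Integration.integrable_bound[OF int_th]) (auto simp: u_def)
  have q_split: "?q z = c * (u z)\<^sup>2 + c * \<eta> * v z" for z
    by (auto simp: quadratic_linear_def u_def v_def)
  have "(\<integral>z. ?q z \<partial>M) = c * (\<integral>z. (u z)\<^sup>2 \<partial>M) + c * \<eta> * (\<integral>z. v z \<partial>M)"
    unfolding q_split using int_u2 int_v by simp
  moreover have "0 \<le> (\<integral>z. (u z)\<^sup>2 \<partial>M)" "0 \<le> (\<integral>z. v z \<partial>M)"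
    by (auto simp: v_def intro!: integral_nonneg_AE)
  \<comment> \<open>Both summands are nonnegative, so each of them alone is bounded by the full
    budget \<open>r\<close>.\<close>
  ultimately have Iu: "(\<integral>z. (u z)\<^sup>2 \<partial>M) \<le> r / c" and Iv: "(\<integral>z. v z \<partial>M) \<le> r / (c * \<eta>)"
    using Iq c \<eta> by (auto simp: field_simps intro: order_trans[rotated])
  have "(\<integral>z. t z * (h z - m) \<partial>M) \<le> (\<integral>z. u z * (h z - m) + 2 * B * v z \<partial>M)"
  proof (rule integral_mono_AE)
    show "AE z in M. t z * (h z - m) \<le> u z * (h z - m) + 2 * B * v z"
      using B
    proof eventually_elim
      case (elim z)
      then have "\<bar>h z - m\<bar> \<le> 2 * B" using m by auto
      then have "\<bar>t z\<bar> * \<bar>h z - m\<bar> \<le> \<bar>t z\<bar> * (2 * B)" by (intro mult_left_mono) auto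
      moreover have "t z * (h z - m) \<le> \<bar>t z\<bar> * \<bar>h z - m\<bar>" by (metis abs_ge_self abs_mult)
      ultimately show ?case by (auto simp: u_def v_def algebra_simps)
    qed
  qed (use int_th int_uh int_v in auto)
  also have "\<dots> = (\<integral>z. u z * (h z - m) \<partial>M) + 2 * B * (\<integral>z. v z \<partial>M)"
    using int_uh int_v by simp
  also have "(\<integral>z. u z * (h z - m) \<partial>M) \<le> sqrt (\<integral>z. (u z)\<^sup>2 \<partial>M) * sqrt (\<integral>z. (h z - m)\<^sup>2 \<partial>M)"
    by (rule Cauchy_Schwarz_integral[OF int_u2 int_h2 int_uh])
  also have "\<dots> \<le> sqrt (r / c) * sqrt (variance_under M h)"
    using Iu unfolding variance_under_eq[OF h B] m_def
    by (intro mult_right_mono) auto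
  also have "2 * B * (\<integral>z. v z \<partial>M) \<le> 2 * B * (r / (c * \<eta>))"
    using Iv B0 by (intro mult_left_mono) auto
  finally show ?thesis using eq by (simp add: m_def real_sqrt_mult [symmetric])
qed

text \<open>The density is 1 almost everywhere and \<open>f 1 = 0\<close>. The centre keeps the
  supremum above the mean, which serves as the lower bound when the variance is small.\<close>

lemma mem_divergence_ball_self:
  assumes f: "smooth_divergence_function f" and "0 \<le> r"
  shows "M \<in> divergence_ball f M r"
proof -
  have "density M (\<lambda>_. 1) = M" by (simp add: density_1)
  then have "AE z in M. 1 = RN_deriv M M z" by (intro RN_deriv_unique) auto
  then have "AE z in M. e2ennreal (f (enn2real (RN_deriv M M z))) = 0"
    using f by (auto simp: smooth_divergence_function_def zero_ereal_def elim!: eventually_mono)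
  then have "(\<integral>\<^sup>+ z. e2ennreal (f (enn2real (RN_deriv M M z))) \<partial>M) = (\<integral>\<^sup>+ z. 0 \<partial>M)"
    by (intro nn_integral_cong_AE)
  then show ?thesis
    by (simp add: divergence_ball_def f_divergence_le_iff[OF assms] prob_space_axioms
        absolutely_continuous_def)
qed

text \<open>The worst case is attained up to second order by the density \<open>1 + a (h - E h)\<close>,
  which is negative at most on a null set, where \<open>ennreal\<close> truncates it to \<open>0\<close>.\<close>

lemma affine_density_in_divergence_ball:
  assumes f: "smooth_divergence_function f" and \<eta>: "0 < \<eta>" "\<eta> < 1"
    and near: "\<And>t. \<bar>t\<bar> \<le> \<eta> \<Longrightarrow> f (1 + t) \<le> ereal (c * t\<^sup>2)"
    and h [measurable]: "h \<in> borel_measurable M" and B: "AE z in M. \<bar>h z\<bar> \<le> B"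
    and a: "0 \<le> a" "a * (2 * B) \<le> \<eta>" and c: "0 \<le> c" and r0: "0 \<le> r" and r: "c * (a\<^sup>2 * variance_under M h) \<le> r"
  shows "\<exists>P \<in> divergence_ball f M r. (\<integral>z. h z \<partial>P) = expectation h + a * variance_under M h"
proof -
  define m where "m = expectation h"
  define t where "t z = a * (h z - m)" for z
  define P where "P = density M (\<lambda>z. ennreal (1 + t z))"
  have [measurable]: "t \<in> borel_measurable M" by (simp add: t_def [abs_def])
  have m: "\<bar>m\<bar> \<le> B" unfolding m_def by (rule abs_expectation_le[OF h B])
  have int_h: "integrable M h" using B by (intro integrable_const_bound[of _ B]) auto
  have int_h2: "integrable M (\<lambda>z. (h z)\<^sup>2)"
    using B by (intro integrable_const_bound[of _ "B\<^sup>2"])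
      (auto simp: power2_le_if_abs_le elim!: eventually_mono)
  \<comment> \<open>The condition on \<open>a * (2 * B)\<close> keeps the density within
    \<open>\<eta>\<close> of 1, where \<open>near\<close> applies; since \<open>\<eta> < 1\<close>,
    it is also positive.\<close>
  have t_le: "AE z in M. \<bar>t z\<bar> \<le> \<eta>"
    using B
  proof eventually_elim
    case (elim z)
    then have "a * \<bar>h z - m\<bar> \<le> a * (2 * B)" using m a by (intro mult_left_mono) auto
    then show ?case using a by (simp add: t_def abs_mult)
  qed
  then have pos: "AE z in M. 0 \<le> 1 + t z" by eventually_elim (use \<eta> in auto)
  have int_t: "integrable M t" "(\<integral>z. t z \<partial>M) = 0"
    using int_h by (auto simp: t_def [abs_def] m_def prob_space)
  have "emeasure P (space P) = (\<integral>\<^sup>+ z. ennreal (1 + t z) \<partial>M)"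
    by (simp add: P_def emeasure_density cong: nn_integral_cong)
  also have "\<dots> = ennreal (\<integral>z. 1 + t z \<partial>M)"
    using int_t pos by (intro nn_integral_eq_integral) auto
  also have "\<dots> = 1" using int_t by (simp add: prob_space)
  finally have prob_P: "prob_space P" by (rule prob_spaceI)
  have "AE z in M. ennreal (1 + t z) = RN_deriv M P z"
    by (intro RN_deriv_unique) (auto simp: P_def)
  then have "AE z in M. e2ennreal (f (enn2real (RN_deriv M P z))) \<le> ennreal (c * (t z)\<^sup>2)"
    using t_le pos
  proof eventually_elim
    case (elim z)
    then have "enn2real (RN_deriv M P z) = 1 + t z" by (metis enn2real_ennreal)
    then show ?case using e2ennreal_mono[OF near[OF elim(2)]] by simp
  qed
  then have "(\<integral>\<^sup>+ z. e2ennreal (f (enn2real (RN_deriv M P z))) \<partial>M) \<le> (\<integral>\<^sup>+ z. ennreal (c * (t z)\<^sup>2) \<partial>M)"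
    by (rule nn_integral_mono_AE)
  also have "\<dots> = ennreal (\<integral>z. c * (t z)\<^sup>2 \<partial>M)"
  proof (rule nn_integral_eq_integral)
    show "integrable M (\<lambda>z. c * (t z)\<^sup>2)"
      using t_le by (intro integrable_mult_right integrable_const_bound[of _ "\<eta>\<^sup>2"])
        (auto simp: power2_le_if_abs_le elim!: eventually_mono)
    show "AE z in M. 0 \<le> c * (t z)\<^sup>2" using c by simp
  qed
  also have "(\<integral>z. c * (t z)\<^sup>2 \<partial>M) = c * (a\<^sup>2 * variance_under M h)"
    unfolding variance_under_eq[OF h B] by (simp add: t_def m_def power_mult_distrib)
  also have "ennreal \<dots> \<le> ennreal r" using r by (rule ennreal_leI)
  finally have "(\<integral>\<^sup>+ z. e2ennreal (f (enn2real (RN_deriv M P z))) \<partial>M) \<le> ennreal r" .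
  then have "P \<in> divergence_ball f M r"
    using prob_P by (simp add: f_divergence_le_iff[OF f r0] divergence_ball_def P_def absolutely_continuousI_density)
  \<comment> \<open>The gain over the mean is the integral of \<open>t * h\<close>, and as
    \<open>t\<close> is \<open>a\<close> times the centred \<open>h\<close>, this is
    \<open>a\<close> times the variance.\<close>
  moreover have "(\<integral>z. h z \<partial>P) = m + a * variance_under M h"
  proof -
    have "(\<integral>z. h z \<partial>P) = (\<integral>z. (1 + t z) * h z \<partial>M)"
      using pos by (simp add: P_def integral_density)
    also have "(\<lambda>z. (1 + t z) * h z) = (\<lambda>z. h z + (a * (h z)\<^sup>2 - a * m * h z))"
      by (auto simp: t_def algebra_simps power2_eq_square)
    also have "(\<integral>z. h z + (a * (h z)\<^sup>2 - a * m * h z) \<partial>M) = m + (a * (\<integral>z. (h z)\<^sup>2 \<partial>M) - a * m * m)"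
      using int_h int_h2 by (simp add: m_def)
    finally show ?thesis by (simp add: variance_under_def m_def power2_eq_square algebra_simps)
  qed
  ultimately show ?thesis unfolding m_def by blast
qed

end

section \<open>Uniform expansion of the worst-case expectation\<close>

text \<open>The crude constant \<open>c = 1/2\<close> bounds the supremum from above and the centre
  of the ball bounds it from below. Hence \<open>real_of_ereal\<close> can be applied to it without
  loss.\<close>

lemma (in prob_space) SUP_divergence_ball_finite:
  assumes f: "smooth_divergence_function f" and h: "h \<in> borel_measurable M"
    and B: "AE z in M. \<bar>h z\<bar> \<le> B" and r: "0 \<le> r"
  shows "\<bar>SUP P \<in> divergence_ball f M r. ereal (\<integral>z. h z \<partial>P)\<bar> \<noteq> \<infinity>"
proof -
  let ?S = "SUP P \<in> divergence_ball f M r. ereal (\<integral>z. h z \<partial>P)"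
  obtain \<eta> where \<eta>: "0 < \<eta>" "\<eta> < 1" "\<And>t. \<bar>t\<bar> \<le> \<eta> \<Longrightarrow> ereal ((1/2) * t\<^sup>2) \<le> f (1 + t)"
    using divergence_function_quadratic[OF f, of "1/2"] by auto
  have "?S \<le> ereal (expectation h + sqrt (r / (1/2) * variance_under M h) + 2 * B * r / ((1/2) * \<eta>))"
    by (intro SUP_least)
      (use expectation_le_of_mem_divergence_ball[OF f \<eta>(1,2) _ \<eta>(3) h B r] in simp)
  moreover have "ereal (expectation h) \<le> ?S"
    by (intro SUP_upper mem_divergence_ball_self f r)
  ultimately show ?thesis by auto
qed

text \<open>Here \<open>\<tau>\<close> is chosen before \<open>Q\<close>, \<open>h\<close> and
  \<open>r\<close>, which later gives uniformity over the sample, the sample size and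
  \<open>H\<close>. The bound on \<open>h\<close> scales like \<open>1 / sqrt r\<close> because the
  term \<open>2 * B * r / (c * \<eta>)\<close> is then of order \<open>sqrt r\<close>, with a factor
  proportional to \<open>\<tau>\<close>.\<close>

lemma divergence_ball_expansion:
  assumes f: "smooth_divergence_function f" and e: "0 < e" and K: "0 < K"
  obtains \<tau> where "0 < \<tau>"
    "\<And>(Q :: 'a measure) h r. prob_space Q \<Longrightarrow> h \<in> borel_measurable Q \<Longrightarrow> 0 < r \<Longrightarrow>
      (AE z in Q. \<bar>h z\<bar> \<le> \<tau> / sqrt r) \<Longrightarrow> variance_under Q h \<le> K \<Longrightarrow>
      \<bar>real_of_ereal (SUP P \<in> divergence_ball f Q r. ereal (\<integral>z. h z \<partial>P)) -
        ((\<integral>z. h z \<partial>Q) + sqrt (r * variance_under Q h))\<bar> \<le> e * sqrt r"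
proof -
  \<comment> \<open>Replacing \<open>f\<close> by a multiple of the square distorts the leading term
    \<open>D\<close> \<le> \<open>sqrt (r * K)\<close> by a relative error of at most
    \<open>2 * \<delta>\<close>; this choice makes the cost at most
    \<open>e / 2 * sqrt r\<close>.\<close>
  define \<delta> where "\<delta> = min (1/2) (e / (4 * (sqrt K + 1)))"
  have sK: "0 < 4 * (sqrt K + 1)" using K by (simp add: add_pos_pos)
  have \<delta>: "0 < \<delta>" "\<delta> \<le> 1/2"
    unfolding \<delta>_def using e sK by (simp, intro min.cobounded1)
  have \<delta>K: "\<delta> * sqrt K \<le> e / 4"
  proof -
    have "\<delta> \<le> e / (4 * (sqrt K + 1))" by (simp add: \<delta>_def)
    then have "\<delta> * (4 * (sqrt K + 1)) \<le> e" using sK by (simp add: pos_le_divide_eq)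
    then show ?thesis using \<delta> by (simp add: algebra_simps)
  qed
  obtain \<eta> where \<eta>: "0 < \<eta>" "\<eta> < 1"
    and near: "\<And>t. \<bar>t\<bar> \<le> \<eta> \<Longrightarrow> ereal ((1 - \<delta>) * t\<^sup>2) \<le> f (1 + t)"
      "\<And>t. \<bar>t\<bar> \<le> \<eta> \<Longrightarrow> f (1 + t) \<le> ereal ((1 + \<delta>) * t\<^sup>2)"
    using divergence_function_quadratic[OF f \<delta>(1)] by blast
  \<comment> \<open>Two demands are met: the large-deviation term is
    \<open>e * sqrt r / (4 * (1 - \<delta>))\<close>, at most \<open>e / 2 * sqrt r\<close>, and in
    the lower bound \<open>2 * \<tau> / e = \<eta> / 4\<close> keeps the affine density
    admissible.\<close>
  define \<tau> where "\<tau> = e * \<eta> / 8"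
  have \<tau>: "0 < \<tau>" using e \<eta> by (simp add: \<tau>_def)
  have main: "\<bar>real_of_ereal (SUP P \<in> divergence_ball f Q r. ereal (\<integral>z. h z \<partial>P)) -
      ((\<integral>z. h z \<partial>Q) + sqrt (r * variance_under Q h))\<bar> \<le> e * sqrt r"
    if "prob_space Q" and h: "h \<in> borel_measurable Q" and r: "0 < r"
      and B: "AE z in Q. \<bar>h z\<bar> \<le> \<tau> / sqrt r" and V_le: "variance_under Q h \<le> K"
    for Q :: "'a measure" and h r
  proof -
    interpret prob_space Q by fact
    let ?S = "SUP P \<in> divergence_ball f Q r. ereal (\<integral>z. h z \<partial>P)"
    define V where "V = variance_under Q h"
    define D where "D = sqrt (r * V)"
    define m where "m = expectation h"
    have V0: "0 \<le> V" unfolding V_def variance_under_eq[OF h B] by simp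
    have D0: "0 \<le> D" and D2: "D\<^sup>2 = r * V" and D: "D = sqrt r * sqrt V"
      using V0 r by (auto simp: D_def real_sqrt_mult power_mult_distrib)
    have \<delta>D: "\<delta> * D \<le> e / 4 * sqrt r"
    proof -
      have "\<delta> * sqrt V \<le> \<delta> * sqrt K" using V_le \<delta> by (intro mult_left_mono) (auto simp: V_def)
      also note \<delta>K
      finally have "\<delta> * sqrt V * sqrt r \<le> e / 4 * sqrt r" using r by (intro mult_right_mono) auto
      then show ?thesis by (simp add: D algebra_simps)
    qed
    obtain S where S: "?S = ereal S"
      using SUP_divergence_ball_finite[OF f h B, of r] r by (cases ?S) auto
    have "S \<le> m + (1 + 2 * \<delta>) * D + e / 2 * sqrt r"
    proof -
      have "sqrt (r / (1 - \<delta>) * V) \<le> (1 + 2 * \<delta>) * D"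
      proof (rule real_le_lsqrt)
        \<comment> \<open>The product \<open>(1 + 2 * \<delta>)\<^sup>2 * (1 - \<delta>)\<close>
          expands to \<open>1 + 3 * \<delta> - 4 * \<delta>^3\<close>, so the cubic term has to be
          absorbed.\<close>
        have "\<delta> * \<delta>\<^sup>2 \<le> \<delta> * (1/2)\<^sup>2" using \<delta> by (intro mult_left_mono power_mono) auto
        then have "1 \<le> (1 + 2 * \<delta>)\<^sup>2 * (1 - \<delta>)"
          using \<delta> by (simp add: power2_eq_square algebra_simps)
        then have "1 * (r * V) \<le> (1 + 2 * \<delta>)\<^sup>2 * (1 - \<delta>) * (r * V)"
          using r V0 by (intro mult_right_mono) auto
        then have "r / (1 - \<delta>) * V \<le> (1 + 2 * \<delta>)\<^sup>2 * (r * V)"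
          using \<delta> by (simp add: field_simps)
        then show "r / (1 - \<delta>) * V \<le> ((1 + 2 * \<delta>) * D)\<^sup>2"
          unfolding power_mult_distrib D2 .
      qed (use \<delta> D0 in auto)
      moreover have "2 * (\<tau> / sqrt r) * r / ((1 - \<delta>) * \<eta>) \<le> e / 2 * sqrt r"
      proof -
        have "2 * (\<tau> / R) * (R * R) / ((1 - \<delta>) * \<eta>) = e * R * (1 / (4 * (1 - \<delta>)))"
          if "0 < R" for R
          using that \<eta> \<delta> by (simp add: \<tau>_def)
        from this[of "sqrt r"]
        have "2 * (\<tau> / sqrt r) * r / ((1 - \<delta>) * \<eta>) = e * sqrt r * (1 / (4 * (1 - \<delta>)))"
          using r by simp
        also have "\<dots> \<le> e * sqrt r * (1/2)"
          using \<delta> e r by (intro mult_left_mono) (auto simp: field_simps)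
        finally show ?thesis by simp
      qed
      moreover have "(\<integral>z. h z \<partial>P) \<le> m + sqrt (r / (1 - \<delta>) * V) + 2 * (\<tau> / sqrt r) * r / ((1 - \<delta>) * \<eta>)"
        if "P \<in> divergence_ball f Q r" for P
        using expectation_le_of_mem_divergence_ball[OF f \<eta> _ near(1) h B _ that] \<delta> r
        by (simp add: m_def V_def)
      ultimately have "?S \<le> ereal (m + (1 + 2 * \<delta>) * D + e / 2 * sqrt r)"
        by (intro SUP_least) force
      then show ?thesis by (simp add: S)
    qed
    \<comment> \<open>If \<open>sqrt V\<close> \<le> \<open>e\<close>, the whole term
      \<open>D\<close> fits into the error and the centre \<open>Q\<close> suffices. Otherwise the
      variance is bounded away from 0, which bounds the slope \<open>a\<close> by
      \<open>sqrt r / e\<close>.\<close>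
    moreover have "m + D - e * sqrt r \<le> S"
    proof (cases "sqrt V \<le> e")
      case True
      then have "D \<le> e * sqrt r" using r by (simp add: D mult.commute)
      moreover have "ereal m \<le> ?S"
        unfolding m_def using r by (intro SUP_upper mem_divergence_ball_self f) auto
      ultimately show ?thesis by (simp add: S)
    next
      case False
      then have V: "0 < V" "e \<le> sqrt V" using e V0 by (auto simp: not_le intro: ccontr)
      \<comment> \<open>The solution of \<open>(1 + \<delta>) * a\<^sup>2 * V = r\<close>: the
        affine density uses up the budget of the upper quadratic bound.\<close>
      define a where "a = sqrt (r / ((1 + \<delta>) * V))"
      have a0: "0 \<le> a" using \<delta> V r by (simp add: a_def)
      have a2: "a\<^sup>2 = r / ((1 + \<delta>) * V)" using \<delta> V r by (simp add: a_def)
      have "a \<le> sqrt (r / V)"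
        unfolding a_def using \<delta> V r by (intro real_sqrt_le_mono divide_left_mono) auto
      also have "\<dots> \<le> sqrt r / e"
        using V e r by (simp add: real_sqrt_divide divide_left_mono)
      finally have "a * (2 * (\<tau> / sqrt r)) \<le> sqrt r / e * (2 * (\<tau> / sqrt r))"
        using \<tau> r by (intro mult_right_mono) auto
      also have "\<dots> \<le> \<eta>" using r e \<eta> by (simp add: \<tau>_def)
      finally have aB: "a * (2 * (\<tau> / sqrt r)) \<le> \<eta>" .
      have "(1 + \<delta>) * (a\<^sup>2 * variance_under Q h) \<le> r"
        using \<delta> V by (simp add: a2 V_def[symmetric])
      from affine_density_in_divergence_ball[OF f \<eta> near(2) h B a0 aB _ _ this] \<delta> r
      obtain P where P: "P \<in> divergence_ball f Q r" "(\<integral>z. h z \<partial>P) = m + a * V"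
        by (auto simp: m_def V_def)
      have "ereal (m + a * V) \<le> ?S"
        unfolding P(2)[symmetric] by (rule SUP_upper[OF P(1)])
      then have "m + a * V \<le> S" by (simp add: S)
      \<comment> \<open>Squared, the right side is \<open>r * V / (1 + \<delta>)\<close>, so the
        claim reduces to \<open>(1 - \<delta>)\<^sup>2 * (1 + \<delta>)\<close> \<le> 1.\<close>
      moreover have "(1 - \<delta>) * D \<le> a * V"
      proof (rule power2_le_imp_le)
        have "(1 - \<delta>)\<^sup>2 * (1 + \<delta>) = (1 - \<delta>) * (1 - \<delta>\<^sup>2)"
          by (simp add: power2_eq_square algebra_simps)
        also have "\<dots> \<le> 1 * 1" using \<delta> by (intro mult_mono) (auto simp: power_le_one)
        finally have "(1 - \<delta>)\<^sup>2 * (1 + \<delta>) * (r * V) \<le> 1 * (r * V)"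
          using r V by (intro mult_right_mono) auto
        then have "(1 - \<delta>)\<^sup>2 * (r * V) \<le> r * V / (1 + \<delta>)"
          using \<delta> by (simp add: field_simps)
        also have "\<dots> = (a * V)\<^sup>2"
          unfolding power_mult_distrib a2 using V by (simp add: power2_eq_square)
        finally show "((1 - \<delta>) * D)\<^sup>2 \<le> (a * V)\<^sup>2"
          by (simp add: power_mult_distrib D2)
      qed (use a0 V in simp)
      moreover have "e / 4 * sqrt r \<le> e * sqrt r" using e r by simp
      ultimately show ?thesis using \<delta>D by (simp add: algebra_simps)
    qed
    ultimately have "\<bar>S - (m + D)\<bar> \<le> e * sqrt r"
      using \<delta>D by (auto simp: algebra_simps abs_le_iff)
    then show ?thesis by (simp add: S m_def D_def V_def)
  qed
  show thesis by (rule that[OF \<tau> main])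
qed

section \<open>Empirical measures of a sample\<close>

text \<open>Everything is pulled back to the uniform measure on the indices. For \<open>n\<close>
  \<ge> 1 each index has positive mass, so a property holds almost everywhere exactly when it holds
  at every sample point.\<close>

lemma
  fixes h :: "'a \<Rightarrow> real"
  assumes x: "x \<in> {..<n} \<rightarrow> space P0" and n: "1 \<le> n"
  shows prob_space_empirical_measure: "prob_space (empirical_measure P0 n x)"
    and AE_empirical_measure:
      "{z \<in> space P0. Q z} \<in> sets P0 \<Longrightarrow>
        (AE z in empirical_measure P0 n x. Q z) \<longleftrightarrow> (\<forall>i<n. Q (x i))"
    and integral_empirical_measure:
      "h \<in> borel_measurable P0 \<Longrightarrow>
        (\<integral>z. h z \<partial>empirical_measure P0 n x) = (\<Sum>i<n. h (x i)) / real n"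
proof -
  have x' [measurable]: "x \<in> measurable (uniform_count_measure {..<n}) P0"
    using x by (auto simp: measurable_def space_uniform_count_measure sets_uniform_count_measure)
  interpret U: prob_space "uniform_count_measure {..<n}"
    using n by (intro prob_space_uniform_count_measure) (auto simp: lessThan_empty_iff)
  show "prob_space (empirical_measure P0 n x)"
    unfolding empirical_measure_def by (rule U.prob_space_distr) measurable
  show "(AE z in empirical_measure P0 n x. Q z) \<longleftrightarrow> (\<forall>i<n. Q (x i))"
    if "{z \<in> space P0. Q z} \<in> sets P0"
    unfolding empirical_measure_def AE_distr_iff[OF x' that]
    unfolding uniform_count_measure_def AE_point_measure using n by auto
  show "(\<integral>z. h z \<partial>empirical_measure P0 n x) = (\<Sum>i<n. h (x i)) / real n"
    if "h \<in> borel_measurable P0"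
    unfolding empirical_measure_def using that
    by (subst integral_distr) (auto simp: integral_uniform_count_measure)
qed

lemma sets_empirical_measure [measurable_cong, simp]: "sets (empirical_measure P0 n x) = sets P0"
  by (simp add: empirical_measure_def)

lemma variance_under_empirical_measure_le:
  assumes x: "x \<in> {..<n} \<rightarrow> space P0" and n: "1 \<le> n" and h: "h \<in> borel_measurable P0"
  shows "variance_under (empirical_measure P0 n x) h \<le> (\<Sum>i<n. (h (x i))\<^sup>2) / real n"
  using integral_empirical_measure[OF x n, of "\<lambda>z. (h z)\<^sup>2"] h by (simp add: variance_under_def)

section \<open>Probability bounds along the sample\<close>

context prob_space begin

lemma identically_distributed_integral:
  fixes u :: "'b \<Rightarrow> real"
  assumes "X \<in> measurable M N" "distr M N X = N" "u \<in> borel_measurable N"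
  shows "expectation (\<lambda>w. u (X w)) = (\<integral>z. u z \<partial>N)"
  using integral_distr[OF assms(1,3)] assms(2) by simp

text \<open>The union bound gives \<open>n\<close> times one tail probability. On the tail event
  \<open>\<tau>\<^sup>2 * n\<close> \<le> \<open>g\<^sup>2\<close>, so this is at most
  \<open>1 / \<tau>\<^sup>2\<close> times the integral of \<open>g\<^sup>2\<close> over the event,
  which vanishes by dominated convergence as the threshold grows.\<close>

lemma prob_sample_max_gt_tendsto_0:
  fixes X :: "nat \<Rightarrow> 'a \<Rightarrow> 'b" and g :: "'b \<Rightarrow> real"
  assumes X [measurable]: "\<And>i. X i \<in> measurable M N" and law: "\<And>i. distr M N (X i) = N"
    and g [measurable]: "g \<in> borel_measurable N" and g2: "integrable N (\<lambda>z. (g z)\<^sup>2)" and \<tau>: "0 < \<tau>"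
  shows "(\<lambda>n. prob (\<Union>i<n. {w \<in> space M. \<tau> * sqrt (real n) < g (X i w)})) \<longlonglongrightarrow> 0"
proof -
  let ?A = "\<lambda>n. {z \<in> space N. \<tau> * sqrt (real n) < g z}"
  let ?s = "\<lambda>n z. indicator (?A n) z * (g z)\<^sup>2"
  have N: "prob_space N" using prob_space_distr[OF X[of 0]] law[of 0] by simp
  interpret N: prob_space N by fact
  have "(\<lambda>n. \<integral>z. ?s n z \<partial>N) \<longlonglongrightarrow> (\<integral>z. 0 \<partial>N)"
  proof (rule integral_dominated_convergence[where w = "\<lambda>z. (g z)\<^sup>2"])
    show "AE z in N. (\<lambda>n. ?s n z) \<longlonglongrightarrow> 0"
    proof (rule AE_I2)
      fix z
      have "filterlim (\<lambda>n. \<tau> * sqrt (real n)) at_top sequentially"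
        by (intro filterlim_tendsto_pos_mult_at_top[OF tendsto_const \<tau>]
            filterlim_compose[OF sqrt_at_top filterlim_real_sequentially])
      then have "\<forall>\<^sub>F n in sequentially. g z \<le> \<tau> * sqrt (real n)"
        by (simp add: filterlim_at_top)
      then have "\<forall>\<^sub>F n in sequentially. ?s n z = 0"
        by eventually_elim (auto simp: indicator_def)
      then show "(\<lambda>n. ?s n z) \<longlonglongrightarrow> 0" by (rule tendsto_eventually)
    qed
  qed (use g2 in \<open>auto simp: indicator_def\<close>)
  then have lim: "(\<lambda>n. (1 / \<tau>\<^sup>2) * (\<integral>z. ?s n z \<partial>N)) \<longlonglongrightarrow> 0"
    by (intro tendsto_mult_right_zero) simp
  have bound: "prob (\<Union>i<n. {w \<in> space M. \<tau> * sqrt (real n) < g (X i w)}) \<le> (1 / \<tau>\<^sup>2) * (\<integral>z. ?s n z \<partial>N)" for n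
  proof -
    have marginal: "prob {w \<in> space M. \<tau> * sqrt (real n) < g (X i w)} = N.prob (?A n)" for i
    proof -
      have "measure (distr M N (X i)) (?A n) = prob (X i -` ?A n \<inter> space M)"
        by (rule measure_distr) auto
      also have "X i -` ?A n \<inter> space M = {w \<in> space M. \<tau> * sqrt (real n) < g (X i w)}"
        using measurable_space[OF X] by auto
      finally show ?thesis by (simp add: law)
    qed
    have "prob (\<Union>i<n. {w \<in> space M. \<tau> * sqrt (real n) < g (X i w)})
        \<le> (\<Sum>i<n. prob {w \<in> space M. \<tau> * sqrt (real n) < g (X i w)})"
      by (intro measure_UNION_le) auto
    also have "\<dots> = (1 / \<tau>\<^sup>2) * (\<integral>z. (\<tau>\<^sup>2 * real n) * indicator (?A n) z \<partial>N)"
      using \<tau> by (simp add: marginal)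
    also have "\<dots> \<le> (1 / \<tau>\<^sup>2) * (\<integral>z. ?s n z \<partial>N)"
    proof (intro mult_left_mono integral_mono)
      show "integrable N (\<lambda>z. ?s n z)"
        by (rule Bochner_Integration.integrable_bound[OF g2]) (auto simp: indicator_def)
      show "integrable N (\<lambda>z. \<tau>\<^sup>2 * real n * indicator (?A n) z)"
        by (intro integrable_mult_right integrable_real_indicator) (auto simp: N.emeasure_eq_measure)
      fix z
      have "\<tau>\<^sup>2 * real n \<le> (g z)\<^sup>2" if "\<tau> * sqrt (real n) < g z"
        using power_mono[of "\<tau> * sqrt (real n)" "g z" 2] that \<tau> by (simp add: power_mult_distrib)
      then show "\<tau>\<^sup>2 * real n * indicator (?A n) z \<le> ?s n z" by (auto simp: indicator_def)
    qed (use \<tau> in auto)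
    finally show ?thesis .
  qed
  show ?thesis
    by (rule tendsto_sandwich[OF _ _ tendsto_const lim]) (use bound in auto)
qed

text \<open>Markov's inequality, as the sample mean has expectation
  \<open>\<integral>z. u z \<partial>N\<close>. The bound is the same for all \<open>n\<close> and
  becomes small through the choice of \<open>K\<close>.\<close>

lemma prob_sample_mean_gt_le:
  fixes X :: "nat \<Rightarrow> 'a \<Rightarrow> 'b" and u :: "'b \<Rightarrow> real"
  assumes X [measurable]: "\<And>i. X i \<in> measurable M N" and law: "\<And>i. distr M N (X i) = N"
    and u: "integrable N u" and nonneg: "\<And>z. 0 \<le> u z" and K: "0 < K" and n: "1 \<le> n"
  shows "prob {w \<in> space M. K < (\<Sum>i<n. u (X i w)) / real n} \<le> (\<integral>z. u z \<partial>N) / K"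
proof -
  have [measurable]: "u \<in> borel_measurable N" using u by simp
  have int: "integrable M (\<lambda>w. u (X i w))" for i
    using integrable_distr[of "X i" M N u] u by (simp add: law)
  have "prob {w \<in> space M. K < (\<Sum>i<n. u (X i w)) / real n}
      \<le> prob {w \<in> space M. K \<le> (\<Sum>i<n. u (X i w)) / real n}"
    by (intro finite_measure_mono) auto
  also have "\<dots> \<le> expectation (\<lambda>w. (\<Sum>i<n. u (X i w)) / real n) / K"
    by (rule integral_Markov_inequality_measure[where A = "{}"])
      (use int nonneg K in \<open>auto intro!: AE_I2 divide_nonneg_nonneg sum_nonneg\<close>)
  also have "expectation (\<lambda>w. (\<Sum>i<n. u (X i w)) / real n) = (\<integral>z. u z \<partial>N)"
    using int n by (simp add: identically_distributed_integral[OF X law])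
  finally show ?thesis .
qed

end

section \<open>The expansion under sampling\<close>

theorem theorem7:
  fixes P0 :: "'a measure" and H :: "('a \<Rightarrow> real) set" and M2 :: "'a \<Rightarrow> real"
    and f :: "real \<Rightarrow> ereal" and \<rho> :: real
    and \<Omega> :: "'w measure" and \<xi> :: "nat \<Rightarrow> 'w \<Rightarrow> 'a"
  assumes P0: "prob_space P0"
    and H_measurable: "\<And>h. h \<in> H \<Longrightarrow> h \<in> borel_measurable P0"
    and H_donsker: "donsker P0 H"
    and M2_measurable: "M2 \<in> borel_measurable P0"
    and M2_nonneg: "\<And>z. z \<in> space P0 \<Longrightarrow> 0 \<le> M2 z"
    and envelope: "\<And>h z. h \<in> H \<Longrightarrow> z \<in> space P0 \<Longrightarrow> \<bar>h z\<bar> \<le> M2 z"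
    and envelope_L2: "integrable P0 (\<lambda>z. (M2 z)\<^sup>2)"
    and f: "smooth_divergence_function f"
    and \<rho>: "\<rho> > 0"
    and \<Omega>: "prob_space \<Omega>"
    and indep: "prob_space.indep_vars \<Omega> (\<lambda>_. P0) \<xi> UNIV"
    and law: "\<And>i. distr \<Omega> P0 (\<xi> i) = P0"
  shows "\<exists>\<epsilon> :: nat \<Rightarrow> 'w \<Rightarrow> ('a \<Rightarrow> real) \<Rightarrow> real.
    (\<forall>n\<ge>1. \<forall>w \<in> space \<Omega>. \<forall>h \<in> H.
       (let Pn = empirical_measure P0 n (\<lambda>i. \<xi> i w) in
          (SUP P \<in> divergence_ball f Pn (\<rho> / real n). ereal (\<integral>z. h z \<partial>P)) =
          ereal ((\<integral>z. h z \<partial>Pn) + sqrt (\<rho> / real n * variance_under Pn h) + \<epsilon> n w h))) \<and>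
    tendsto_zero_in_outer_prob \<Omega>
      (\<lambda>n w. SUP h \<in> H. ennreal (sqrt (real n) * \<bar>\<epsilon> n w h\<bar>))"
proof -
  interpret \<Omega>: prob_space \<Omega> by fact
  have \<xi> [measurable]: "\<xi> i \<in> measurable \<Omega> P0" for i
    using indep unfolding \<Omega>.indep_vars_def by auto
  note M2_measurable [measurable]
  define Pn where "Pn n w = empirical_measure P0 n (\<lambda>i. \<xi> i w)" for n w
  define S where "S n w h = (SUP P \<in> divergence_ball f (Pn n w) (\<rho> / real n). ereal (\<integral>z. h z \<partial>P))"
    for n w and h :: "'a \<Rightarrow> real"
  \<comment> \<open>With the error defined by subtraction, the claimed identity amounts to
    finiteness of the supremum.\<close>
  define \<epsilon> where "\<epsilon> n w h = real_of_ereal (S n w h) -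
      ((\<integral>z. h z \<partial>Pn n w) + sqrt (\<rho> / real n * variance_under (Pn n w) h))"
    for n w and h :: "'a \<Rightarrow> real"
  have sample: "(\<lambda>i. \<xi> i w) \<in> {..<n} \<rightarrow> space P0" if "w \<in> space \<Omega>" for n w
    using measurable_space[OF \<xi>] that by auto
  have AE_h: "AE z in Pn n w. \<bar>h z\<bar> \<le> B"
    if "w \<in> space \<Omega>" "1 \<le> n" "h \<in> H" "\<And>i. i < n \<Longrightarrow> M2 (\<xi> i w) \<le> B" for n w h B
  proof -
    have [measurable]: "h \<in> borel_measurable P0" using that by (intro H_measurable)
    have meas: "{z \<in> space P0. \<bar>h z\<bar> \<le> B} \<in> sets P0" by measurable
    show ?thesis
      unfolding Pn_def AE_empirical_measure[OF sample[OF that(1)] that(2) meas]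
      using order_trans[OF envelope[OF that(3) measurable_space[OF \<xi> that(1)]] that(4)] by simp
  qed
  have S_eq: "S n w h = ereal ((\<integral>z. h z \<partial>Pn n w) + sqrt (\<rho> / real n * variance_under (Pn n w) h) + \<epsilon> n w h)"
    if "w \<in> space \<Omega>" "1 \<le> n" "h \<in> H" for n w h
  proof -
    interpret Q: prob_space "Pn n w"
      unfolding Pn_def using prob_space_empirical_measure[OF sample] that by blast
    \<comment> \<open>Any finite bound serves here; the sum dominates each envelope value because
      all of them are nonnegative.\<close>
    have "AE z in Pn n w. \<bar>h z\<bar> \<le> (\<Sum>i<n. M2 (\<xi> i w))"
      using that by (intro AE_h member_le_sum) (auto intro!: M2_nonneg measurable_space[OF \<xi>])
    then have "\<bar>S n w h\<bar> \<noteq> \<infinity>"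
      unfolding S_def using that H_measurable \<rho>
      by (intro Q.SUP_divergence_ball_finite[OF f]) (auto simp: Pn_def cong: measurable_cong_sets)
    then show ?thesis by (simp add: \<epsilon>_def ereal_real)
  qed
  have "tendsto_zero_in_outer_prob \<Omega> (\<lambda>n w. SUP h \<in> H. ennreal (sqrt (real n) * \<bar>\<epsilon> n w h\<bar>))"
    unfolding tendsto_zero_in_outer_prob_def
  proof (intro allI impI)
    fix e :: real assume e: "0 < e"
    let ?bad = "\<lambda>n. {w \<in> space \<Omega>. ennreal e < (SUP h \<in> H. ennreal (sqrt (real n) * \<bar>\<epsilon> n w h\<bar>))}"
    have small: "\<forall>\<^sub>F n in sequentially. outer_measure_of \<Omega> (?bad n) < c" if c: "0 < c" for c
    proof -
      obtain k :: real where k: "0 < k" "ennreal k < c"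
        using c by (metis ennreal_less_zero_iff ennreal_cases dense less_top_ennreal order_less_trans ennreal_less_iff not_less_zero zero_less_iff_neq_zero ennreal_0)
      define E where "E = (\<integral>z. (M2 z)\<^sup>2 \<partial>P0)"
      \<comment> \<open>Then \<open>E / K = k / 2 * (E / (E + 1))\<close>; the summand 1 makes the
        inequality with \<open>k / 2\<close> strict and keeps \<open>K\<close> positive when
        \<open>E = 0\<close>.\<close>
      define K where "K = 2 * (E + 1) / k"
      have E: "0 \<le> E" by (simp add: E_def)
      have K: "0 < K" "E / K < k / 2" using E k by (auto simp: K_def field_simps)
      \<comment> \<open>The tolerance is divided by \<open>sqrt \<rho>\<close> so that for
        \<open>r = \<rho> / n\<close> the error \<open>e / sqrt \<rho> * sqrt r\<close>, multiplied
        by \<open>sqrt n\<close>, is exactly \<open>e\<close>.\<close>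
      have epos: "0 < e / sqrt \<rho>" using e \<rho> by simp
      obtain \<tau> where \<tau>: "0 < \<tau>" and exp: "\<And>(Q :: 'a measure) h r. prob_space Q \<Longrightarrow> h \<in> borel_measurable Q \<Longrightarrow> 0 < r \<Longrightarrow>
          (AE z in Q. \<bar>h z\<bar> \<le> \<tau> / sqrt r) \<Longrightarrow> variance_under Q h \<le> K \<Longrightarrow>
          \<bar>real_of_ereal (SUP P \<in> divergence_ball f Q r. ereal (\<integral>z. h z \<partial>P)) -
            ((\<integral>z. h z \<partial>Q) + sqrt (r * variance_under Q h))\<bar> \<le> e / sqrt \<rho> * sqrt r"
        by (rule divergence_ball_expansion[OF f epos K(1) that])
      let ?A = "\<lambda>n. \<Union>i<n. {w \<in> space \<Omega>. \<tau> / sqrt \<rho> * sqrt (real n) < M2 (\<xi> i w)}"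
      let ?C = "\<lambda>n. {w \<in> space \<Omega>. K < (\<Sum>i<n. (M2 (\<xi> i w))\<^sup>2) / real n}"
      have "(\<lambda>n. \<Omega>.prob (?A n)) \<longlonglongrightarrow> 0"
        by (rule \<Omega>.prob_sample_max_gt_tendsto_0[OF \<xi> law M2_measurable envelope_L2]) (use \<tau> \<rho> in simp)
      then have "\<forall>\<^sub>F n in sequentially. \<Omega>.prob (?A n) < k / 2"
        using k by (intro order_tendstoD(2)) auto
      then show ?thesis
        using eventually_ge_at_top[of 1]
      proof eventually_elim
        case (elim n)
        \<comment> \<open>The supremum over \<open>H\<close> need not be measurable, whence the
          outer measure. The covering events involve only \<open>M2\<close> and are measurable; off
          them every \<open>h\<close> in \<open>H\<close> meets both conditions of the uniform
          expansion.\<close>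
        have "?bad n \<subseteq> ?A n \<union> ?C n"
        proof (rule ccontr)
          assume "\<not> ?thesis"
          then obtain w where w: "w \<in> space \<Omega>" "w \<notin> ?A n" "w \<notin> ?C n"
            and gt: "ennreal e < (SUP h \<in> H. ennreal (sqrt (real n) * \<bar>\<epsilon> n w h\<bar>))" by blast
          have M2_le: "M2 (\<xi> i w) \<le> \<tau> / sqrt (\<rho> / real n)" if "i < n" for i
            using w that by (auto simp: real_sqrt_divide not_less)
          have "sqrt (real n) * \<bar>\<epsilon> n w h\<bar> \<le> e" if h: "h \<in> H" for h
          proof -
            have [measurable]: "h \<in> borel_measurable P0" using h by (rule H_measurable)
            have "(\<Sum>i<n. (h (\<xi> i w))\<^sup>2) \<le> (\<Sum>i<n. (M2 (\<xi> i w))\<^sup>2)"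
              using envelope[OF h measurable_space[OF \<xi> w(1)]]
              by (intro sum_mono power2_le_if_abs_le)
            then have "(\<Sum>i<n. (h (\<xi> i w))\<^sup>2) / real n \<le> (\<Sum>i<n. (M2 (\<xi> i w))\<^sup>2) / real n"
              by (intro divide_right_mono) auto
            also have "\<dots> \<le> K" using w by auto
            finally have V: "variance_under (Pn n w) h \<le> K"
              using variance_under_empirical_measure_le[OF sample[OF w(1)] elim(2), of h] h H_measurable
              unfolding Pn_def by auto
            have "\<bar>\<epsilon> n w h\<bar> \<le> e / sqrt \<rho> * sqrt (\<rho> / real n)"
              unfolding \<epsilon>_def S_def
            proof (rule exp[OF _ _ _ _ V])
              show "prob_space (Pn n w)"
                unfolding Pn_def by (rule prob_space_empirical_measure[OF sample[OF w(1)] elim(2)])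
              show "h \<in> borel_measurable (Pn n w)" by (simp add: Pn_def cong: measurable_cong_sets)
              show "0 < \<rho> / real n" using \<rho> elim by simp
              show "AE z in Pn n w. \<bar>h z\<bar> \<le> \<tau> / sqrt (\<rho> / real n)"
                using w(1) elim(2) h M2_le by (rule AE_h)
            qed
            also have "\<dots> = e / sqrt (real n)" using \<rho> by (simp add: real_sqrt_divide)
            finally show ?thesis using elim by (simp add: field_simps)
          qed
          then have "(SUP h \<in> H. ennreal (sqrt (real n) * \<bar>\<epsilon> n w h\<bar>)) \<le> ennreal e"
            by (intro SUP_least ennreal_leI)
          with gt show False by simp
        qed
        then have "outer_measure_of \<Omega> (?bad n) \<le> outer_measure_of \<Omega> (?A n \<union> ?C n)"
          by (rule outer_measure_of_mono)
        also have "\<dots> = ennreal (\<Omega>.prob (?A n \<union> ?C n))"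
          by (subst outer_measure_of_eq) (measurable, simp add: \<Omega>.emeasure_eq_measure)
        also have "\<Omega>.prob (?A n \<union> ?C n) \<le> \<Omega>.prob (?A n) + \<Omega>.prob (?C n)"
          by (intro measure_Un_le) measurable
        also have "\<Omega>.prob (?C n) \<le> E / K"
          unfolding E_def by (rule \<Omega>.prob_sample_mean_gt_le[OF \<xi> law envelope_L2 _ K(1) elim(2)]) simp
        also have "\<Omega>.prob (?A n) + E / K \<le> k" using elim(1) K(2) by linarith
        also have "ennreal k < c" by fact
        finally show ?case by (simp add: ennreal_leI)
      qed
    qed
    show "(\<lambda>n. outer_measure_of \<Omega> (?bad n)) \<longlonglongrightarrow> 0"
      by (rule order_tendstoI) (use small in auto)
  qed
  then show ?thesis
    using S_eq unfolding S_def Pn_def Let_def by blast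
qed

end
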